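(* Let $a_n$ ($n\in\mathbb{Z}$) and $b_m$ ($m\in\mathbb{Z}$) be non-zero real numbers with $a_n\neq b_m$ for all $n,m$. Let $\tau_n^m=\tau_n^m(x,t;y)$ be a nowhere vanishing complex-valued function of $(m,n)\in\mathbb{Z}^2$ and $(x,t,y)\in\mathbb{R}^3$, smooth in $(x,t,y)$, which satisfies, for all $m,n$, the bilinear equations $$\tfrac12 D_xD_y\,\tau_n^m\cdot\tau_n^m=-(\tau^{*m}_{n})^2,\qquad D_x^2\,\tau_n^m\cdot\tau^{*m}_{n}=0,\qquad (D_x^3+D_t)\,\tau_n^m\cdot\tau^{*m}_{n}=0,$$ $$D_y\,\tau_{n+1}^m\cdot\tau_n^m=-a_n\,\tau^{*m}_{n+1}\tau^{*m}_{n},\qquad D_y\,\tau_{n}^{m+1}\cdot\tau_n^m=-b_m\,\tau^{*\,m+1}_{n}\tau^{*m}_{n},$$ $$b_m\,\tau^{*\,m+1}_{n}\tau_{n+1}^m-a_n\,\tau^{*m}_{n+1}\tau_n^{m+1}+(a_n-b_m)\,\tau^{*\,m+1}_{n+1}\tau_n^m=0 .$$ Define a real function $\Theta_n^m(x,t;y)$ and an $\mathbb{R}^2$-valued function $\gamma_n^m(x,t;y)$ by $$\Theta_n^m:=\frac{2}{\sqrt{-1}}\log\frac{\tau_n^m}{\tau^{*m}_{n}},\qquad \gamma_n^m:=\begin{bmatrix}-\frac12\left(\log \tau_n^m\tau^{*m}_{n}\right)_y\\[1mm] \frac{1}{2\sqrt{-1}}\left(\log\frac{\tau_n^m}{\tau^{*m}_{n}}\right)_y\end{bmatrix}.$$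 (1) For any $m,n\in\mathbb{Z}$ and $y\in\mathbb{R}$, the functions $\theta(x,t)=\Theta_n^m(x,t;y)$ and $\gamma(x,t)=\gamma_n^m(x,t;y)$ satisfy, with $\kappa=\theta_x$ and $'=\partial/\partial x$, $$\gamma''=\begin{bmatrix}0&-\kappa\\ \kappa&0\end{bmatrix}\gamma',\qquad \frac{\partial}{\partial t}\gamma'=\begin{bmatrix}0&\kappa''+\frac{\kappa^3}{2}\\ -\kappa''-\frac{\kappa^3}{2}&0\end{bmatrix}\gamma',\qquad \theta_t+\tfrac12(\theta_x)^3+\theta_{xxx}=0 .$$ (2) For any $x,t,y\in\mathbb{R}$, the functions $\Theta_n^m=\Theta_n^m(x,t;y)$ and $\gamma_n^m=\gamma_n^m(x,t;y)$ satisfy, for all $m,n\in\mathbb{Z}$, $$\left|\frac{\gamma_{n+1}^m-\gamma_n^m}{a_n}\right|=1,\qquad \frac{\gamma_{n+1}^m-\gamma_n^m}{a_n}=R(K_n^m)\,\frac{\gamma_n^m-\gamma_{n-1}^m}{a_{n-1}},\qquad \frac{\gamma_n^{m+1}-\gamma_n^m}{b_m}=R(W_n^m)\,\frac{\gamma_{n+1}^m-\gamma_n^m}{a_n},$$ where $$W_n^m=\frac{\Theta_n^{m+1}-\Theta_{n+1}^m}{2},\qquad K_n^m=\frac{\Theta_{n+1}^m-\Theta_{n-1}^m}{2},$$ and the discrete potential mKdV equation $$\tan\left(\frac{\Theta_{n+1}^{m+1}-\Theta_n^m}{4}\right)=\frac{b_m+a_n}{b_m-a_n}\,\tan\left(\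frac{\Theta_n^{m+1}-\Theta_{n+1}^m}{4}\right).$$
   Context: ${}^*$ denotes complex conjugation, so $\tau^{*m}_n$ is the complex conjugate of $\tau_n^m$. $D_x,D_y,D_t$ are Hirota's bilinear operators: $$D_x^iD_y^jD_t^k\,f\cdot g=\left.(\partial_x-\partial_{x'})^i(\partial_y-\partial_{y'})^j(\partial_t-\partial_{t'})^k f(x,y,t)\,g(x',y',t')\right|_{x'=x,\,y'=y,\,t'=t}.$$ $R(\phi)=\begin{pmatrix}\cos\phi&-\sin\phi\\ \sin\phi&\cos\phi\end{pmatrix}$ is the rotation matrix. The logarithm in $\Theta_n^m$ is a branch that is smooth in $(x,t,y)$; thus $\Theta_n^m$ is real and $e^{\sqrt{-1}\,\Theta_n^m/2}=\tau_n^m/\tau^{*m}_n$. An equation $\tan\alpha=\frac{p+q}{p-q}\tan\beta$ with $p\ne q$ is understood in the cross-multiplied form $(p-q)\sin\alpha\cos\beta=(p+q)\cos\alpha\sin\beta$ if a tangent is undefined. *)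

theory Defs
  imports "HOL-Analysis.Analysis"
begin

text \<open>
  Lattice functions are written with the superscript first, \<open>\<tau> m n\<close> for \<open>\<tau>\<^sub>n\<^sup>m\<close>,
  and the continuous variables always come in the order \<open>x t y\<close>.
\<close>

primrec Ck :: "nat \<Rightarrow> ('a::real_normed_vector \<Rightarrow> 'b::real_normed_vector) \<Rightarrow> bool" where
  "Ck 0 f \<longleftrightarrow> continuous_on UNIV f"
| "Ck (Suc k) f \<longleftrightarrow>
     (\<forall>p. f differentiable (at p)) \<and> (\<forall>v. Ck k (\<lambda>p. frechet_derivative f (at p) v))"

definition smooth3 :: "(real \<Rightarrow> real \<Rightarrow> real \<Rightarrow> 'b::real_normed_vector) \<Rightarrow> bool" where
  "smooth3 f \<longleftrightarrow> (\<forall>k. Ck k (\<lambda>(x, t, y). f x t y))"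

definition pd1 :: "(real \<Rightarrow> real \<Rightarrow> 'b::real_normed_vector) \<Rightarrow> real \<Rightarrow> real \<Rightarrow> 'b" where
  "pd1 f = (\<lambda>x t. vector_derivative (\<lambda>s. f s t) (at x))"

definition pd2 :: "(real \<Rightarrow> real \<Rightarrow> 'b::real_normed_vector) \<Rightarrow> real \<Rightarrow> real \<Rightarrow> 'b" where
  "pd2 f = (\<lambda>x t. vector_derivative (\<lambda>s. f x s) (at t))"

text \<open>
  The operators \<open>\<partial>\<^sub>x - \<partial>\<^sub>x\<^sub>'\<close>, \<open>\<partial>\<^sub>y - \<partial>\<^sub>y\<^sub>'\<close> and \<open>\<partial>\<^sub>t - \<partial>\<^sub>t\<^sub>'\<close>, on functions
  of the six variables \<open>x t y x' t' y'\<close>.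
\<close>

type_synonym fun6 = "real \<Rightarrow> real \<Rightarrow> real \<Rightarrow> real \<Rightarrow> real \<Rightarrow> real \<Rightarrow> complex"

definition hirota_x :: "fun6 \<Rightarrow> fun6" where
  "hirota_x F = (\<lambda>x t y x' t' y'.
     vector_derivative (\<lambda>s. F s t y x' t' y') (at x)
     - vector_derivative (\<lambda>s. F x t y s t' y') (at x'))"

definition hirota_y :: "fun6 \<Rightarrow> fun6" where
  "hirota_y F = (\<lambda>x t y x' t' y'.
     vector_derivative (\<lambda>s. F x t s x' t' y') (at y)
     - vector_derivative (\<lambda>s. F x t y x' t' s) (at y'))"

definition hirota_t :: "fun6 \<Rightarrow> fun6" where
  "hirota_t F = (\<lambda>x t y x' t' y'.
     vector_derivative (\<lambda>s. F x s y x' t' y') (at t)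
     - vector_derivative (\<lambda>s. F x t y x' s y') (at t'))"

text \<open>\<open>hirota i j k f g\<close> is \<open>D\<^sub>x\<^sup>i D\<^sub>y\<^sup>j D\<^sub>t\<^sup>k f \<cdot> g\<close>: the second exponent belongs to \<open>y\<close>, the third to \<open>t\<close>.\<close>

definition hirota ::
  "nat \<Rightarrow> nat \<Rightarrow> nat \<Rightarrow> (real \<Rightarrow> real \<Rightarrow> real \<Rightarrow> complex) \<Rightarrow> (real \<Rightarrow> real \<Rightarrow> real \<Rightarrow> complex)
     \<Rightarrow> real \<Rightarrow> real \<Rightarrow> real \<Rightarrow> complex" where
  "hirota i j k f g = (\<lambda>x t y.
     (hirota_x ^^ i) ((hirota_y ^^ j) ((hirota_t ^^ k)
       (\<lambda>x t y x' t' y'. f x t y * g x' t' y'))) x t y x t y)"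

definition conj3 ::
  "(real \<Rightarrow> real \<Rightarrow> real \<Rightarrow> complex) \<Rightarrow> real \<Rightarrow> real \<Rightarrow> real \<Rightarrow> complex" where
  "conj3 f = (\<lambda>x t y. cnj (f x t y))"

text \<open>
  The principal logarithm \<open>Ln\<close> is discontinuous along the negative axis, so
  \<open>log (\<tau> / \<tau>\<^sup>*)\<close> is represented by a function \<open>L\<close> of which only smoothness and
  \<open>exp L = \<tau> / \<tau>\<^sup>*\<close> are required.
\<close>

definition smooth_log_branch ::
  "(real \<Rightarrow> real \<Rightarrow> real \<Rightarrow> complex) \<Rightarrow> (real \<Rightarrow> real \<Rightarrow> real \<Rightarrow> complex) \<Rightarrow> bool" where
  "smooth_log_branch L f \<longleftrightarrow> smooth3 L \<and> (\<forall>x t y. exp (L x t y) = f x t y)"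

text \<open>
  In the next two definitions \<open>Re\<close> only converts types: \<open>L\<close> is purely imaginary,
  as \<open>\<bar>\<tau> / \<tau>\<^sup>*\<bar> = 1\<close>, and \<open>\<tau> \<tau>\<^sup>*\<close> is real and positive, so that \<open>ln\<close> is real and smooth there.
\<close>

definition Theta :: "(real \<Rightarrow> real \<Rightarrow> real \<Rightarrow> complex) \<Rightarrow> real \<Rightarrow> real \<Rightarrow> real \<Rightarrow> real" where
  "Theta L x t y = Re (2 / \<i> * L x t y)"

definition gamma_curve ::
  "(real \<Rightarrow> real \<Rightarrow> real \<Rightarrow> complex) \<Rightarrow> (real \<Rightarrow> real \<Rightarrow> real \<Rightarrow> complex)
     \<Rightarrow> real \<Rightarrow> real \<Rightarrow> real \<Rightarrow> real ^ 2" where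
  "gamma_curve \<tau> L x t y = vector
     [Re (- (1 / 2) * vector_derivative (\<lambda>s. ln (\<tau> x t s * cnj (\<tau> x t s))) (at y)),
      Re (1 / (2 * \<i>) * vector_derivative (\<lambda>s. L x t s) (at y))]"

definition mat2 :: "real \<Rightarrow> real \<Rightarrow> real \<Rightarrow> real \<Rightarrow> real ^ 2 ^ 2" where
  "mat2 p q r s = vector [vector [p, q], vector [r, s]]"

definition rot :: "real \<Rightarrow> real ^ 2 ^ 2" where
  "rot \<phi> = mat2 (cos \<phi>) (- sin \<phi>) (sin \<phi>) (cos \<phi>)"

text \<open>
  \<open>tan_eq \<alpha> p q \<beta>\<close> is \<open>tan \<alpha> = (p + q) / (p - q) * tan \<beta>\<close>, for \<open>p \<noteq> q\<close>, in the
  cross-multiplied form where a tangent is undefined (\<open>tan\<close> is \<open>0\<close> at its poles in HOL).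
\<close>

definition tan_eq :: "real \<Rightarrow> real \<Rightarrow> real \<Rightarrow> real \<Rightarrow> bool" where
  "tan_eq \<alpha> p q \<beta> \<longleftrightarrow>
     (if cos \<alpha> \<noteq> 0 \<and> cos \<beta> \<noteq> 0
      then tan \<alpha> = (p + q) / (p - q) * tan \<beta>
      else (p - q) * sin \<alpha> * cos \<beta> = (p + q) * cos \<alpha> * sin \<beta>)"

end

theory Submission
  imports Defs
begin

text \<open>
  Identify the plane with \<open>\<complex>\<close>. Then \<open>\<gamma> = - (log \<tau>\<^sup>*)\<^sub>y\<close>, and with \<open>u = \<tau> / \<tau>\<^sup>* = exp (\<i> \<Theta> / 2)\<close> the
  first bilinear equation says \<open>\<gamma>\<^sub>x = u\<^sup>2 = exp (\<i> \<Theta>)\<close>, while the two \<open>D\<^sub>y\<close> equations say that the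
  edges of the lattice are products such as \<open>a\<^sub>n u\<^sub>n u\<^sub>n\<^sub>+\<^sub>1\<close>. The frame equations and the rotations are
  read off from the exponents. Substituting \<open>\<tau> = e\<^sup>L \<tau>\<^sup>*\<close> in the \<open>D\<^sub>x\<^sup>2\<close> equation and eliminating in the
  \<open>D\<^sub>x\<^sup>3 + D\<^sub>t\<close> equation gives \<open>L\<^sub>t + L\<^sub>x\<^sub>x\<^sub>x = 2 L\<^sub>x\<^sup>3\<close>. The last bilinear equation, in the polar form
  \<open>\<tau> = r exp (\<i> \<Theta> / 4)\<close> with \<open>r\<close> real of either sign, has real and imaginary parts whose quotient is the
  discrete potential mKdV equation.
\<close>

section \<open>Partial derivatives of smooth functions of three variables\<close>

definition dx :: "(real \<Rightarrow> real \<Rightarrow> real \<Rightarrow> 'b::real_normed_vector) \<Rightarrow> real \<Rightarrow> real \<Rightarrow> real \<Rightarrow> 'b" where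
  "dx f = (\<lambda>x t y. vector_derivative (\<lambda>s. f s t y) (at x))"

definition dt :: "(real \<Rightarrow> real \<Rightarrow> real \<Rightarrow> 'b::real_normed_vector) \<Rightarrow> real \<Rightarrow> real \<Rightarrow> real \<Rightarrow> 'b" where
  "dt f = (\<lambda>x t y. vector_derivative (\<lambda>s. f x s y) (at t))"

definition dy :: "(real \<Rightarrow> real \<Rightarrow> real \<Rightarrow> 'b::real_normed_vector) \<Rightarrow> real \<Rightarrow> real \<Rightarrow> real \<Rightarrow> 'b" where
  "dy f = (\<lambda>x t y. vector_derivative (\<lambda>s. f x t s) (at y))"

lemma smooth3_has_derivative:
  assumes "smooth3 f"
  shows "((\<lambda>(x, t, y). f x t y) has_derivative
    frechet_derivative (\<lambda>(x, t, y). f x t y) (at p)) (at p)"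
proof -
  have "Ck (Suc 0) (\<lambda>(x, t, y). f x t y)"
    using assms unfolding smooth3_def by blast
  then show ?thesis
    unfolding Ck.simps frechet_derivative_works by blast
qed

lemma smooth3_has_directional_derivative:
  assumes "smooth3 f" and "(c has_vector_derivative v) (at s)"
  shows "((\<lambda>s. case c s of (x, t, y) \<Rightarrow> f x t y) has_vector_derivative
    frechet_derivative (\<lambda>(x, t, y). f x t y) (at (c s)) v) (at s)"
  using vector_derivative_diff_chain_within[OF assms(2)
      has_derivative_at_withinI[OF smooth3_has_derivative[OF assms(1)]]]
  by (simp add: o_def)

text \<open>\<open>Ck (Suc k)\<close> demands \<open>Ck k\<close> of the Frechet derivative in every
  fixed direction, so smoothness passes to directional derivatives.\<close>

lemma smooth3_directional_derivative:
  assumes "smooth3 f"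
    and "\<And>x t y. g x t y = frechet_derivative (\<lambda>(x, t, y). f x t y) (at (x, t, y)) v"
  shows "smooth3 g"
proof -
  have "(\<lambda>(x, t, y). g x t y) = (\<lambda>p. frechet_derivative (\<lambda>(x, t, y). f x t y) (at p) v)"
    by (auto simp: fun_eq_iff assms(2))
  moreover have "Ck (Suc k) (\<lambda>(x, t, y). f x t y)" for k
    using assms(1) unfolding smooth3_def by blast
  ultimately show ?thesis
    unfolding smooth3_def Ck.simps by metis
qed

text \<open>Partial derivatives are the Frechet derivative in the coordinate directions, so they
  exist, and those in \<open>x\<close> and \<open>y\<close> can be iterated.\<close>

lemma
  assumes "smooth3 f"
  shows has_vector_derivative_dx: "((\<lambda>s. f s t y) has_vector_derivative dx f x t y) (at x)"
    and has_vector_derivative_dt: "((\<lambda>s. f x s y) has_vector_derivative dt f x t y) (at t)"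
    and has_vector_derivative_dy: "((\<lambda>s. f x t s) has_vector_derivative dy f x t y) (at y)"
    and smooth3_dx: "smooth3 (dx f)"
    and smooth3_dy: "smooth3 (dy f)"
proof -
  let ?D = "\<lambda>p. frechet_derivative (\<lambda>(x, t, y). f x t y) (at p)"
  have 1: "((\<lambda>s. f s t y) has_vector_derivative ?D (x, t, y) (1, 0, 0)) (at x)" for x t y
    using smooth3_has_directional_derivative[OF assms, of "\<lambda>s. (s, t, y)" "(1, 0, 0)" x]
    by (simp add: has_vector_derivative_Pair)
  have 2: "((\<lambda>s. f x s y) has_vector_derivative ?D (x, t, y) (0, 1, 0)) (at t)" for x t y
    using smooth3_has_directional_derivative[OF assms, of "\<lambda>s. (x, s, y)" "(0, 1, 0)" t]
    by (simp add: has_vector_derivative_Pair)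
  have 3: "((\<lambda>s. f x t s) has_vector_derivative ?D (x, t, y) (0, 0, 1)) (at y)" for x t y
    using smooth3_has_directional_derivative[OF assms, of "\<lambda>s. (x, t, s)" "(0, 0, 1)" y]
    by (simp add: has_vector_derivative_Pair)
  have e1: "dx f x t y = ?D (x, t, y) (1, 0, 0)" for x t y
    unfolding dx_def by (rule vector_derivative_at[OF 1])
  have e2: "dt f x t y = ?D (x, t, y) (0, 1, 0)" for x t y
    unfolding dt_def by (rule vector_derivative_at[OF 2])
  have e3: "dy f x t y = ?D (x, t, y) (0, 0, 1)" for x t y
    unfolding dy_def by (rule vector_derivative_at[OF 3])
  show "((\<lambda>s. f s t y) has_vector_derivative dx f x t y) (at x)"
    "((\<lambda>s. f x s y) has_vector_derivative dt f x t y) (at t)"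
    "((\<lambda>s. f x t s) has_vector_derivative dy f x t y) (at y)"
    using 1 2 3 by (simp_all add: e1 e2 e3)
  show "smooth3 (dx f)" "smooth3 (dy f)"
    using smooth3_directional_derivative[OF assms e1] smooth3_directional_derivative[OF assms e3] .
qed

text \<open>A bounded linear map commutes with the Frechet derivative, so the induction hypothesis
  is needed for every directional derivative of \<open>f\<close>.\<close>

lemma Ck_bounded_linear:
  assumes "bounded_linear h" and "Ck k f"
  shows "Ck k (\<lambda>p. h (f p))"
  using assms(2)
proof (induction k arbitrary: f)
  case 0
  then show ?case
    using bounded_linear.continuous_on[OF assms(1)] by simp
next
  case (Suc k)
  have d: "((\<lambda>p. h (f p)) has_derivative (\<lambda>v. h (frechet_derivative f (at p) v))) (at p)" for p
    using Suc.prems by (intro bounded_linear.has_derivative[OF assms(1)])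
      (simp add: frechet_derivative_works)
  have "frechet_derivative (\<lambda>p. h (f p)) (at p) = (\<lambda>v. h (frechet_derivative f (at p) v))" for p
    using frechet_derivative_at[OF d] by simp
  then show ?case
    using d Suc by (auto simp: differentiable_def)
qed

lemma smooth3_conj3: "smooth3 f \<Longrightarrow> smooth3 (conj3 f)"
  using Ck_bounded_linear[OF bounded_linear_cnj, of _ "\<lambda>(x, t, y). f x t y"]
  unfolding smooth3_def conj3_def by (simp add: case_prod_unfold)

section \<open>Hirota derivatives in terms of partial derivatives\<close>

lemma
  assumes "smooth3 f" and "smooth3 g"
  shows hirota_x_mult: "hirota_x (\<lambda>x t y x' t' y'. f x t y * g x' t' y')
      = (\<lambda>x t y x' t' y'. dx f x t y * g x' t' y' - f x t y * dx g x' t' y')"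
    and hirota_t_mult: "hirota_t (\<lambda>x t y x' t' y'. f x t y * g x' t' y')
      = (\<lambda>x t y x' t' y'. dt f x t y * g x' t' y' - f x t y * dt g x' t' y')"
    and hirota_y_mult: "hirota_y (\<lambda>x t y x' t' y'. f x t y * g x' t' y')
      = (\<lambda>x t y x' t' y'. dy f x t y * g x' t' y' - f x t y * dy g x' t' y')"
  \<comment> \<open>The two factors depend on separate triples of variables, so for each partial
    derivative one of them is a constant.\<close>
  unfolding hirota_x_def hirota_t_def hirota_y_def fun_eq_iff
  by (intro allI arg_cong2[where f = minus] vector_derivative_at
      derivative_eq_intros has_vector_derivative_dx has_vector_derivative_dt
      has_vector_derivative_dy assms has_vector_derivative_mult_left
      has_vector_derivative_mult_right)+

lemma hirota_x_diff:
  assumes "\<And>x t y x' t' y'. (\<lambda>s. F s t y x' t' y') differentiable (at x)"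
    and "\<And>x t y x' t' y'. (\<lambda>s. F x t y s t' y') differentiable (at x')"
    and "\<And>x t y x' t' y'. (\<lambda>s. G s t y x' t' y') differentiable (at x)"
    and "\<And>x t y x' t' y'. (\<lambda>s. G x t y s t' y') differentiable (at x')"
  shows "hirota_x (\<lambda>x t y x' t' y'. F x t y x' t' y' - G x t y x' t' y')
    = (\<lambda>x t y x' t' y'. hirota_x F x t y x' t' y' - hirota_x G x t y x' t' y')"
  unfolding hirota_x_def fun_eq_iff
  by (simp add: vector_derivative_diff_at assms)

lemma differentiable_x: "smooth3 f \<Longrightarrow> (\<lambda>s. f s t y) differentiable (at x)"
  by (rule differentiableI_vector[OF has_vector_derivative_dx])

text \<open>Each operator turns a product of a function of \<open>x t y\<close> and one of
  \<open>x' t' y'\<close> into a difference of such products. By linearity the next operator acts on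
  each product separately; restriction to the diagonal comes last.\<close>

lemma
  assumes f: "smooth3 f" and g: "smooth3 g"
  shows hirota_1_1_0: "hirota 1 1 0 f g x t y = dx (dy f) x t y * g x t y - dy f x t y * dx g x t y
      - (dx f x t y * dy g x t y - f x t y * dx (dy g) x t y)"
    and hirota_2_0_0: "hirota 2 0 0 f g x t y
      = dx (dx f) x t y * g x t y - 2 * dx f x t y * dx g x t y + f x t y * dx (dx g) x t y"
    and hirota_3_0_0: "hirota 3 0 0 f g x t y
      = dx (dx (dx f)) x t y * g x t y - 3 * dx (dx f) x t y * dx g x t y
        + 3 * dx f x t y * dx (dx g) x t y - f x t y * dx (dx (dx g)) x t y"
    and hirota_0_0_1: "hirota 0 0 1 f g x t y = dt f x t y * g x t y - f x t y * dt g x t y"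
    and hirota_0_1_0: "hirota 0 1 0 f g x t y = dy f x t y * g x t y - f x t y * dy g x t y"
  unfolding hirota_def numeral_2_eq_2 numeral_3_eq_3 One_nat_def funpow.simps comp_apply id_apply
  by (simp_all only: hirota_x_mult hirota_t_mult hirota_y_mult hirota_x_diff differentiable_x
      differentiable_diff differentiable_mult differentiable_const smooth3_dx smooth3_dy f g)
    (simp_all add: algebra_simps)

section \<open>The plane as the complex numbers\<close>

definition cvec :: "complex \<Rightarrow> real ^ 2" where
  "cvec z = vector [Re z, Im z]"

lemma bounded_linear_cvec: "bounded_linear cvec"
  unfolding linear_conv_bounded_linear[symmetric]
  by (rule linearI) (simp_all add: cvec_def vec_eq_iff forall_2)

lemma norm_cvec: "norm (cvec z) = norm z"
  by (simp add: cvec_def norm_vec_def L2_set_def sum_2 cmod_def)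

text \<open>Case \<open>p = 0\<close> gives the matrices of the frame equations, and cosine and sine
  give the rotations.\<close>

lemma mat2_mult_cvec: "mat2 p (- q) q p *v cvec z = cvec (Complex p q * z)"
  by (simp add: cvec_def mat2_def vec_eq_iff forall_2 matrix_vector_mult_def sum_2)

lemma rot_mult_cvec: "rot \<phi> *v cvec z = cvec (cis \<phi> * z)"
  unfolding rot_def mat2_mult_cvec cis.code ..

text \<open>The derivative is again an exponential times a function, so the rule can be applied
  repeatedly.\<close>

lemma has_vector_derivative_exp_mult:
  fixes l h :: "real \<Rightarrow> complex"
  assumes "(l has_vector_derivative l') (at s)" and "(h has_vector_derivative h') (at s)"
  shows "((\<lambda>s. exp (l s) * h s) has_vector_derivative exp (l s) * (l' * h s + h')) (at s)"
proof -
  have "((exp \<circ> l) has_vector_derivative l' * exp (l s)) (at s)"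
    by (rule field_vector_diff_chain_at[OF assms(1) DERIV_exp])
  from has_vector_derivative_mult[OF this assms(2)] show ?thesis
    by (simp add: o_def algebra_simps)
qed

section \<open>The logarithm branch and its derivatives\<close>

lemma
  fixes L f :: "real \<Rightarrow> real \<Rightarrow> real \<Rightarrow> complex"
  assumes br: "smooth_log_branch L (\<lambda>x t y. f x t y / cnj (f x t y))"
    and nz: "\<And>x t y. f x t y \<noteq> 0"
  shows log_branch_smooth: "smooth3 L"
    and log_branch_exp: "exp (L x t y) = f x t y / cnj (f x t y)"
    and log_branch_Re: "Re (L x t y) = 0"
    and Theta_eq: "Theta L x t y = 2 * Im (L x t y)"
proof -
  show "smooth3 L" and e: "exp (L x t y) = f x t y / cnj (f x t y)"
    using br unfolding smooth_log_branch_def by auto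
  \<comment> \<open>A number divided by its conjugate has modulus 1, and the modulus of an
    exponential sees only the real part.\<close>
  have "exp (Re (L x t y)) = norm (exp (L x t y))"
    by simp
  also have "\<dots> = 1"
    unfolding e using nz by (simp add: norm_divide)
  finally show "Re (L x t y) = 0"
    by simp
  show "Theta L x t y = 2 * Im (L x t y)"
    by (simp add: Theta_def)
qed

lemma dx_imaginary:
  assumes "smooth3 L" and "\<And>x t y. Re (L x t y) = 0"
  shows "Re (dx L x t y) = 0"
proof -
  have "((\<lambda>s. Re (L s t y)) has_vector_derivative Re (dx L x t y)) (at x)"
    by (intro bounded_linear.has_vector_derivative[OF bounded_linear_Re]
        has_vector_derivative_dx assms)
  then have "((\<lambda>s. 0) has_vector_derivative Re (dx L x t y)) (at x)"
    by (simp add: assms)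
  then show ?thesis
    using has_vector_derivative_const vector_derivative_unique_at by blast
qed

lemma dt_imaginary:
  assumes "smooth3 L" and "\<And>x t y. Re (L x t y) = 0"
  shows "Re (dt L x t y) = 0"
proof -
  have "((\<lambda>s. Re (L x s y)) has_vector_derivative Re (dt L x t y)) (at t)"
    by (intro bounded_linear.has_vector_derivative[OF bounded_linear_Re]
        has_vector_derivative_dt assms)
  then have "((\<lambda>s. 0) has_vector_derivative Re (dt L x t y)) (at t)"
    by (simp add: assms)
  then show ?thesis
    using has_vector_derivative_const vector_derivative_unique_at by blast
qed

lemma
  assumes "smooth3 L"
  shows pd1_Im: "pd1 (\<lambda>x t. 2 * Im (L x t y)) = (\<lambda>x t. 2 * Im (dx L x t y))"
    and pd2_Im: "pd2 (\<lambda>x t. 2 * Im (L x t y)) = (\<lambda>x t. 2 * Im (dt L x t y))"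
  unfolding pd1_def pd2_def fun_eq_iff
  by (intro allI vector_derivative_at has_vector_derivative_mult_right
      bounded_linear.has_vector_derivative[OF bounded_linear_Im]
      has_vector_derivative_dx has_vector_derivative_dt assms)+

text \<open>With \<open>exp (2 * L)\<close> as the tangent of the curve, these are its derivatives.
  For imaginary \<open>L\<close> the factors in front are imaginary and become the skew-symmetric
  matrices.\<close>

lemma
  assumes "smooth3 L"
  shows pd1_cvec_exp: "pd1 (\<lambda>x t. cvec (exp (2 * L x t y)))
      = (\<lambda>x t. cvec (2 * dx L x t y * exp (2 * L x t y)))"
    and pd2_cvec_exp: "pd2 (\<lambda>x t. cvec (exp (2 * L x t y)))
      = (\<lambda>x t. cvec (2 * dt L x t y * exp (2 * L x t y)))"
proof -
  have "((\<lambda>s. exp (2 * L s t y)) has_vector_derivative 2 * dx L x t y * exp (2 * L x t y)) (at x)"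
    for x t
    using has_vector_derivative_exp_mult[OF has_vector_derivative_mult_right
        [OF has_vector_derivative_dx[OF assms]] has_vector_derivative_const[of 1], of 2]
    by (simp add: mult.commute)
  then show "pd1 (\<lambda>x t. cvec (exp (2 * L x t y)))
      = (\<lambda>x t. cvec (2 * dx L x t y * exp (2 * L x t y)))"
    unfolding pd1_def fun_eq_iff
    by (intro allI vector_derivative_at bounded_linear.has_vector_derivative[OF bounded_linear_cvec])
  have "((\<lambda>s. exp (2 * L x s y)) has_vector_derivative 2 * dt L x t y * exp (2 * L x t y)) (at t)"
    for x t
    using has_vector_derivative_exp_mult[OF has_vector_derivative_mult_right
        [OF has_vector_derivative_dt[OF assms]] has_vector_derivative_const[of 1], of 2]
    by (simp add: mult.commute)
  then show "pd2 (\<lambda>x t. cvec (exp (2 * L x t y)))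
      = (\<lambda>x t. cvec (2 * dt L x t y * exp (2 * L x t y)))"
    unfolding pd2_def fun_eq_iff
    by (intro allI vector_derivative_at bounded_linear.has_vector_derivative[OF bounded_linear_cvec])
qed

section \<open>The potential mKdV equation for the logarithm\<close>

lemma bilinear_imp_mkdv:
  fixes L f g :: "real \<Rightarrow> real \<Rightarrow> real \<Rightarrow> complex"
  assumes L: "smooth3 L" and f: "smooth3 f" and g: "smooth3 g"
    and gnz: "\<And>x t y. g x t y \<noteq> 0"
    and e: "\<And>x t y. exp (L x t y) = f x t y / g x t y"
    and bil2: "hirota 2 0 0 f g x t y = 0"
    and bil3: "hirota 3 0 0 f g x t y + hirota 0 0 1 f g x t y = 0"
  shows "dt L x t y + dx (dx (dx L)) x t y = 2 * dx L x t y ^ 3"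
proof -
  note d = has_vector_derivative_dx[OF L] has_vector_derivative_dx[OF smooth3_dx[OF L]]
    has_vector_derivative_dx[OF smooth3_dx[OF smooth3_dx[OF L]]]
    has_vector_derivative_dx[OF g] has_vector_derivative_dx[OF smooth3_dx[OF g]]
    has_vector_derivative_dx[OF smooth3_dx[OF smooth3_dx[OF g]]]
  define E where "E = exp (L x t y)"
  \<comment> \<open>Writing \<open>f\<close> as \<open>exp L * g\<close> keeps all derivatives free of quotients.\<close>
  have f0: "f = (\<lambda>x t y. exp (L x t y) * g x t y)"
    by (simp add: e gnz fun_eq_iff)
  have ft: "dt f x t y = exp (L x t y) * (dt L x t y * g x t y + dt g x t y)"
    unfolding dt_def[of f] unfolding f0
    by (intro vector_derivative_at has_vector_derivative_exp_mult has_vector_derivative_dt L g)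
  have f1: "dx f = (\<lambda>x t y. exp (L x t y) * (dx L x t y * g x t y + dx g x t y))"
    unfolding dx_def[of f] fun_eq_iff unfolding f0
    by (intro allI vector_derivative_at has_vector_derivative_exp_mult d)
  have f2: "dx (dx f) = (\<lambda>x t y. exp (L x t y) * (dx L x t y * (dx L x t y * g x t y + dx g x t y)
      + (dx L x t y * dx g x t y + dx (dx L) x t y * g x t y + dx (dx g) x t y)))"
    unfolding dx_def[of "dx f"] fun_eq_iff unfolding f1
    by (intro allI vector_derivative_at has_vector_derivative_exp_mult
        has_vector_derivative_add has_vector_derivative_mult d)
  have f3: "dx (dx (dx f)) = (\<lambda>x t y. exp (L x t y)
      * (dx L x t y * (dx L x t y * (dx L x t y * g x t y + dx g x t y)
      + (dx L x t y * dx g x t y + dx (dx L) x t y * g x t y + dx (dx g) x t y))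
      + (dx L x t y * (dx L x t y * dx g x t y + dx (dx L) x t y * g x t y + dx (dx g) x t y)
          + dx (dx L) x t y * (dx L x t y * g x t y + dx g x t y)
        + (dx L x t y * dx (dx g) x t y + dx (dx L) x t y * dx g x t y
          + (dx (dx L) x t y * dx g x t y + dx (dx (dx L)) x t y * g x t y)
          + dx (dx (dx g)) x t y))))"
    unfolding dx_def[of "dx (dx f)"] fun_eq_iff unfolding f2
    by (intro allI vector_derivative_at has_vector_derivative_exp_mult
        has_vector_derivative_add has_vector_derivative_mult d)
  define G l where "G = g x t y" and "l = dx L x t y"
  define g1 g2 where "g1 = dx g x t y" and "g2 = dx (dx g) x t y"
  define l2 l3 lt where "l2 = dx (dx L) x t y" and "l3 = dx (dx (dx L)) x t y" and "lt = dt L x t y"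
  \<comment> \<open>Higher derivatives of \<open>f\<close> are replaced first, since rewriting
    \<open>f\<close> itself would destroy the left-hand sides of \<open>f1\<close> and
    \<open>f2\<close>. In both equations the derivatives of \<open>g\<close> survive only in the
    combination \<open>G * g2 - g1\<^sup>2\<close>.\<close>
  have "E * ((l2 + l\<^sup>2) * G\<^sup>2 + 2 * (G * g2 - g1\<^sup>2)) = 0"
    using bil2[unfolded hirota_2_0_0[OF f g], unfolded f2, unfolded f1, unfolded f0]
    by (simp add: E_def G_def l_def g1_def g2_def l2_def algebra_simps power2_eq_square)
  then have "(l2 + l\<^sup>2) * G\<^sup>2 + 2 * (G * g2 - g1\<^sup>2) = 0"
    by (simp add: E_def)
  moreover have "E * ((lt + l3 + 3 * l * l2 + l ^ 3) * G\<^sup>2 + 6 * l * (G * g2 - g1\<^sup>2)) = 0"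
    using bil3[unfolded hirota_3_0_0[OF f g] hirota_0_0_1[OF f g], unfolded ft,
        unfolded f3, unfolded f2, unfolded f1, unfolded f0]
    by (simp add: E_def G_def l_def g1_def g2_def l2_def l3_def lt_def algebra_simps
        power2_eq_square power3_eq_cube)
  then have "(lt + l3 + 3 * l * l2 + l ^ 3) * G\<^sup>2 + 6 * l * (G * g2 - g1\<^sup>2) = 0"
    by (simp add: E_def)
  \<comment> \<open>Subtracting \<open>3 * l\<close> times the first equation from the second
    eliminates \<open>G * g2 - g1\<^sup>2\<close> together with \<open>l2\<close>.\<close>
  ultimately have "(lt + l3 - 2 * l ^ 3) * G\<^sup>2 = 0"
    by algebra
  then show ?thesis
    using gnz by (simp add: G_def l_def l3_def lt_def)
qed

section \<open>The tangent and the edges of the curve\<close>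

text \<open>With \<open>p = dy f / f\<close>, the logarithms of \<open>f * cnj f\<close> and
  \<open>f / cnj f\<close> have the \<open>y\<close>-derivatives \<open>p + cnj p\<close> and
  \<open>p - cnj p\<close>, so the two components are \<open>- Re p\<close> and
  \<open>Im p\<close>.\<close>

lemma gamma_curve_eq:
  assumes sm: "smooth3 f" and nz: "\<And>x t y. f x t y \<noteq> 0"
    and br: "smooth_log_branch L (\<lambda>x t y. f x t y / cnj (f x t y))"
  shows "gamma_curve f L x t y = cvec (- cnj (dy f x t y / f x t y))"
proof -
  note nz[simp]
  note L = log_branch_smooth[OF br nz] and e = log_branch_exp[OF br nz]
  let ?p = "dy f x t y / f x t y"
  have df: "((\<lambda>s. f x t s) has_vector_derivative dy f x t y) (at y)"
    by (rule has_vector_derivative_dy[OF sm])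
  have dL: "((\<lambda>s. L x t s) has_vector_derivative dy L x t y) (at y)"
    by (rule has_vector_derivative_dy[OF L])
  \<comment> \<open>Differentiating the identity \<open>exp L * cnj f = f\<close> determines
    \<open>dy L\<close>, whatever the branch.\<close>
  have "((\<lambda>s. exp (L x t s) * cnj (f x t s)) has_vector_derivative
      exp (L x t y) * (dy L x t y * cnj (f x t y) + cnj (dy f x t y))) (at y)"
    by (intro has_vector_derivative_exp_mult dL has_vector_derivative_cnj df)
  then have "((\<lambda>s. f x t s) has_vector_derivative
      exp (L x t y) * (dy L x t y * cnj (f x t y) + cnj (dy f x t y))) (at y)"
    by (simp add: e)
  from vector_derivative_unique_at[OF this df]
  have "f x t y / cnj (f x t y) * (dy L x t y * cnj (f x t y) + cnj (dy f x t y)) = dy f x t y"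
    by (simp add: e)
  then have Ly: "dy L x t y = ?p - cnj ?p"
    by (simp add: field_simps)
  let ?r = "f x t y * cnj (f x t y)"
  \<comment> \<open>The product is real and positive, hence off the branch cut of the complex
    logarithm.\<close>
  have "?r \<notin> \<real>\<^sub>\<le>\<^sub>0"
    unfolding complex_norm_square[symmetric] complex_nonpos_Reals_iff by simp
  then have "((ln \<circ> (\<lambda>s. f x t s * cnj (f x t s))) has_vector_derivative
      (f x t y * cnj (dy f x t y) + dy f x t y * cnj (f x t y)) * inverse ?r) (at y)"
    by (intro field_vector_diff_chain_at has_vector_derivative_mult has_vector_derivative_cnj df
        has_field_derivative_Ln)
  then have "vector_derivative (\<lambda>s. ln (f x t s * cnj (f x t s))) (at y)
      = (f x t y * cnj (dy f x t y) + dy f x t y * cnj (f x t y)) * inverse ?r"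
    by (simp add: o_def vector_derivative_at)
  also have "\<dots> = ?p + cnj ?p"
    by (simp add: field_simps)
  finally show ?thesis
    unfolding gamma_curve_def vector_derivative_at[OF dL] Ly cvec_def
    by (simp del: complex_cnj_divide)
qed

text \<open>In the quotient rule for \<open>dy f / f\<close> the numerator is half of
  \<open>hirota 1 1 0 f f\<close>. Since \<open>2 * L\<close> is \<open>\<i>\<close> times
  \<open>Theta\<close>, the tangent has length 1 and angle \<open>Theta\<close>.\<close>

lemma pd1_gamma_curve:
  assumes sm: "smooth3 f" and nz: "\<And>x t y. f x t y \<noteq> 0"
    and br: "smooth_log_branch L (\<lambda>x t y. f x t y / cnj (f x t y))"
    and bil1: "\<And>x t y. 1 / 2 * hirota 1 1 0 f f x t y = - (cnj (f x t y))\<^sup>2"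
  shows "pd1 (\<lambda>x t. gamma_curve f L x t y) = (\<lambda>x t. cvec (exp (2 * L x t y)))"
proof -
  note nz[simp]
  have "((\<lambda>s. - cnj (dy f s t y / f s t y)) has_vector_derivative exp (2 * L x t y)) (at x)" for x t
  proof -
    note df = has_vector_derivative_dx[OF sm, of t y x]
    let ?d = "dy f x t y * (dx f x t y * - (inverse (f x t y) ^ Suc (Suc 0)))
      + dx (dy f) x t y * inverse (f x t y)"
    have "((inverse \<circ> (\<lambda>s. f s t y)) has_vector_derivative
        dx f x t y * - (inverse (f x t y) ^ Suc (Suc 0))) (at x)"
      by (intro field_vector_diff_chain_at df DERIV_inverse) simp
    from has_vector_derivative_minus[OF has_vector_derivative_cnj[OF
          has_vector_derivative_mult[OF has_vector_derivative_dx[OF smooth3_dy[OF sm]] this]]]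
    have d: "((\<lambda>s. - cnj (dy f s t y / f s t y)) has_vector_derivative - cnj ?d) (at x)"
      by (simp add: o_def divide_inverse)
    have "?d = (dx (dy f) x t y * f x t y - dy f x t y * dx f x t y) / (f x t y)\<^sup>2"
      by (simp add: field_simps power2_eq_square)
    also have "dx (dy f) x t y * f x t y - dy f x t y * dx f x t y = - (cnj (f x t y))\<^sup>2"
      using bil1[of x t y] unfolding hirota_1_1_0[OF sm sm] by (simp add: algebra_simps)
    finally have "- cnj ?d = (f x t y / cnj (f x t y))\<^sup>2"
      by (simp add: power_divide)
    also have "\<dots> = exp (2 * L x t y)"
      unfolding exp_double log_branch_exp[OF br nz] ..
    finally show ?thesis
      using d by simp
  qed
  then show ?thesis
    unfolding pd1_def gamma_curve_eq[OF sm nz br] fun_eq_iff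
    by (intro allI vector_derivative_at bounded_linear.has_vector_derivative[OF bounded_linear_cvec])
qed

text \<open>The difference of the logarithmic derivatives of \<open>g\<close> and \<open>f\<close>
  has numerator \<open>hirota 0 1 0 g f\<close>. Both lattice directions are instances, with
  \<open>c\<close> equal to \<open>a n\<close> or \<open>b m\<close>; the angle of the normalised
  edge is the mean of the two values of \<open>Theta\<close>.\<close>

lemma gamma_curve_diff:
  assumes f: "smooth3 f" "\<And>x t y. f x t y \<noteq> 0"
      "smooth_log_branch L (\<lambda>x t y. f x t y / cnj (f x t y))"
    and g: "smooth3 g" "\<And>x t y. g x t y \<noteq> 0"
      "smooth_log_branch M (\<lambda>x t y. g x t y / cnj (g x t y))"
    and bil: "hirota 0 1 0 g f x t y = - of_real c * cnj (g x t y) * cnj (f x t y)"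
    and c: "c \<noteq> 0"
  shows "(gamma_curve g M x t y - gamma_curve f L x t y) /\<^sub>R c
    = cvec (cis (Im (M x t y) + Im (L x t y)))"
proof -
  interpret bounded_linear cvec by (rule bounded_linear_cvec)
  have "cis (Im (M x t y) + Im (L x t y)) = exp (M x t y) * exp (L x t y)"
    using log_branch_Re[OF f(3,2)] log_branch_Re[OF g(3,2)]
    by (simp add: exp_eq_polar cis_mult)
  also have "\<dots> = g x t y / cnj (g x t y) * (f x t y / cnj (f x t y))"
    unfolding log_branch_exp[OF f(3,2)] log_branch_exp[OF g(3,2)] ..
  finally have u: "cis (Im (M x t y) + Im (L x t y)) =
    g x t y / cnj (g x t y) * (f x t y / cnj (f x t y))" .
  have "dy g x t y / g x t y - dy f x t y / f x t y
      = - of_real c * cnj (g x t y / cnj (g x t y) * (f x t y / cnj (f x t y)))"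
  proof -
    have "dy g x t y / g x t y - dy f x t y / f x t y
        = (dy g x t y * f x t y - g x t y * dy f x t y) / (g x t y * f x t y)"
      using f(2) g(2) by (simp add: field_simps)
    also have "\<dots> = (- of_real c * cnj (g x t y) * cnj (f x t y)) / (g x t y * f x t y)"
      unfolding bil[unfolded hirota_0_1_0[OF g(1) f(1)]] ..
    finally show ?thesis
      by simp
  qed
  \<comment> \<open>Points of the curve are negated conjugates of logarithmic derivatives.\<close>
  from arg_cong[OF this, of cnj]
  have "- cnj (dy g x t y / g x t y) - - cnj (dy f x t y / f x t y)
      = c *\<^sub>R cis (Im (M x t y) + Im (L x t y))"
    unfolding u by (simp add: scaleR_conv_of_real algebra_simps)
  then show ?thesis
    unfolding gamma_curve_eq[OF f] gamma_curve_eq[OF g] diff[symmetric] scaleR[symmetric]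
    using c by simp
qed

section \<open>The discrete potential mKdV equation\<close>

text \<open>As \<open>z = cnj z * cis u\<close>, the number \<open>z * cis (- (u / 2))\<close> is
  its own conjugate, hence real. Halving the angle leaves the sign open, so \<open>r\<close> need
  not be positive.\<close>

lemma log_branch_polar:
  assumes "exp (\<i> * of_real u) = z / cnj z" and "z \<noteq> 0"
  obtains r where "z = of_real r * cis (u / 2)" and "r \<noteq> 0"
proof -
  let ?w = "z * cis (- (u / 2))"
  have "cis u = cis (u / 2) * cis (u / 2)"
    by (simp add: cis_mult)
  moreover have "z = cnj z * cis u"
    unfolding cis_conv_exp assms(1) using assms(2) by simp
  ultimately have "z = cnj z * (cis (u / 2) * cis (u / 2))"
    by simp
  then have "?w = cnj z * (cis (u / 2) * (cis (u / 2) * cis (- (u / 2))))"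
    by (metis mult.assoc)
  then have "cnj ?w = ?w"
    by (simp add: cis_mult cis_cnj)
  then have "?w \<in> \<real>"
    using Reals_cnj_iff by blast
  then obtain r where r: "?w = of_real r"
    by (auto elim: Reals_cases)
  have "z = ?w * cis (u / 2)"
    by (simp add: cis_mult mult.assoc)
  with r assms(2) that[of r] show ?thesis
    by auto
qed

text \<open>The two digits in the names are the shifts of \<open>m\<close> and of \<open>n\<close>.
  In polar form each product in \<open>bil\<close> is a real coefficient times \<open>cis\<close> of
  a half-difference of the angles \<open>u\<close>.\<close>

lemma discrete_potential_mkdv:
  fixes a b u00 u10 u01 u11 :: real and z00 z10 z01 z11 :: complex
  assumes ab: "a \<noteq> b"
    and e: "exp (\<i> * of_real u00) = z00 / cnj z00" "exp (\<i> * of_real u10) = z10 / cnj z10"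
      "exp (\<i> * of_real u01) = z01 / cnj z01" "exp (\<i> * of_real u11) = z11 / cnj z11"
    and nz: "z00 \<noteq> 0" "z10 \<noteq> 0" "z01 \<noteq> 0" "z11 \<noteq> 0"
    and bil: "of_real b * cnj z10 * z01 - of_real a * cnj z01 * z10
      + of_real (a - b) * cnj z11 * z00 = 0"
  shows "tan_eq ((u11 - u00) / 2) b a ((u10 - u01) / 2)"
proof -
  obtain r00 where r00: "z00 = of_real r00 * cis (u00 / 2)" "r00 \<noteq> 0"
    by (rule log_branch_polar[OF e(1) nz(1)])
  obtain r10 where r10: "z10 = of_real r10 * cis (u10 / 2)" "r10 \<noteq> 0"
    by (rule log_branch_polar[OF e(2) nz(2)])
  obtain r01 where r01: "z01 = of_real r01 * cis (u01 / 2)" "r01 \<noteq> 0"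
    by (rule log_branch_polar[OF e(3) nz(3)])
  obtain r11 where r11: "z11 = of_real r11 * cis (u11 / 2)" "r11 \<noteq> 0"
    by (rule log_branch_polar[OF e(4) nz(4)])
  define \<alpha> \<beta> where "\<alpha> = (u10 - u01) / 2" and "\<beta> = (u11 - u00) / 2"
  define A B where "A = r10 * r01" and "B = r11 * r00"
  have c: "cnj (cis (v / 2)) * cis (w / 2) = cis (- ((v - w) / 2))" for v w
    by (simp add: cis_cnj cis_mult diff_divide_distrib)
  have "of_real (b * A) * cis (- \<alpha>) - of_real (a * A) * cis \<alpha> + of_real ((a - b) * B) * cis (- \<beta>)
      = of_real b * cnj z10 * z01 - of_real a * cnj z01 * z10 + of_real (a - b) * cnj z11 * z00"
    using c[of u10 u01] c[of u01 u10] c[of u11 u00]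
    unfolding r00 r10 r01 r11 A_def B_def \<alpha>_def \<beta>_def
    by (simp add: minus_divide_left algebra_simps)
  also note bil
  finally have *: "of_real (b * A) * cis (- \<alpha>) - of_real (a * A) * cis \<alpha>
      + of_real ((a - b) * B) * cis (- \<beta>) = 0" .
  \<comment> \<open>In the real part both coefficients are multiples of \<open>a - b\<close>; the
    imaginary part keeps \<open>a + b\<close>.\<close>
  have "(a - b) * (B * cos \<beta> - A * cos \<alpha>) = 0"
    using arg_cong[OF *, of Re] by (simp add: algebra_simps)
  then have 1: "A * cos \<alpha> = B * cos \<beta>"
    using ab by simp
  have 2: "(b - a) * B * sin \<beta> = (b + a) * A * sin \<alpha>"
    using arg_cong[OF *, of Im] by (simp add: algebra_simps)
  \<comment> \<open>The two relations are divided by cross-multiplication, so no cosine has to be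
    non-zero, and the result serves both cases of \<open>tan_eq\<close>.\<close>
  have "B * ((b - a) * sin \<beta> * cos \<alpha>) = B * ((b + a) * cos \<beta> * sin \<alpha>)"
    using 1 2 by algebra
  then have 3: "(b - a) * sin \<beta> * cos \<alpha> = (b + a) * cos \<beta> * sin \<alpha>"
    using r11(2) r00(2) by (simp add: B_def)
  then show ?thesis
    using ab unfolding tan_eq_def \<alpha>_def[symmetric] \<beta>_def[symmetric]
    by (simp add: tan_def field_simps)
qed

theorem theorem3p1:
  fixes a b :: "int \<Rightarrow> real"
    and \<tau> L :: "int \<Rightarrow> int \<Rightarrow> real \<Rightarrow> real \<Rightarrow> real \<Rightarrow> complex"
  assumes a_nz: "\<And>n. a n \<noteq> 0"
    and b_nz: "\<And>m. b m \<noteq> 0"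
    and ab: "\<And>n m. a n \<noteq> b m"
    and tau_nz: "\<And>m n x t y. \<tau> m n x t y \<noteq> 0"
    and tau_smooth: "\<And>m n. smooth3 (\<tau> m n)"
    and bil1: "\<And>m n x t y.
      1 / 2 * hirota 1 1 0 (\<tau> m n) (\<tau> m n) x t y = - (cnj (\<tau> m n x t y))\<^sup>2"
    and bil2: "\<And>m n x t y. hirota 2 0 0 (\<tau> m n) (conj3 (\<tau> m n)) x t y = 0"
    and bil3: "\<And>m n x t y.
      hirota 3 0 0 (\<tau> m n) (conj3 (\<tau> m n)) x t y
        + hirota 0 0 1 (\<tau> m n) (conj3 (\<tau> m n)) x t y = 0"
    and bil4: "\<And>m n x t y.
      hirota 0 1 0 (\<tau> m (n + 1)) (\<tau> m n) x t y
        = - of_real (a n) * cnj (\<tau> m (n + 1) x t y) * cnj (\<tau> m n x t y)"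
    and bil5: "\<And>m n x t y.
      hirota 0 1 0 (\<tau> (m + 1) n) (\<tau> m n) x t y
        = - of_real (b m) * cnj (\<tau> (m + 1) n x t y) * cnj (\<tau> m n x t y)"
    and bil6: "\<And>m n x t y.
      of_real (b m) * cnj (\<tau> (m + 1) n x t y) * \<tau> m (n + 1) x t y
        - of_real (a n) * cnj (\<tau> m (n + 1) x t y) * \<tau> (m + 1) n x t y
        + of_real (a n - b m) * cnj (\<tau> (m + 1) (n + 1) x t y) * \<tau> m n x t y = 0"
    and log_branch: "\<And>m n.
      smooth_log_branch (L m n) (\<lambda>x t y. \<tau> m n x t y / cnj (\<tau> m n x t y))"
  shows
    "(\<forall>m n y.
        let \<theta> = (\<lambda>x t. Theta (L m n) x t y);
            \<gamma> = (\<lambda>x t. gamma_curve (\<tau> m n) (L m n) x t y);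
            \<kappa> = pd1 \<theta>
        in \<forall>x t.
          pd1 (pd1 \<gamma>) x t = mat2 0 (- \<kappa> x t) (\<kappa> x t) 0 *v pd1 \<gamma> x t \<and>
          pd2 (pd1 \<gamma>) x t =
            mat2 0 (pd1 (pd1 \<kappa>) x t + (\<kappa> x t) ^ 3 / 2)
                 (- pd1 (pd1 \<kappa>) x t - (\<kappa> x t) ^ 3 / 2) 0 *v pd1 \<gamma> x t \<and>
          pd2 \<theta> x t + 1 / 2 * (pd1 \<theta> x t) ^ 3 + pd1 (pd1 (pd1 \<theta>)) x t = 0)
     \<and>
     (\<forall>x t y.
        let \<Theta> = (\<lambda>m n. Theta (L m n) x t y);
            \<gamma> = (\<lambda>m n. gamma_curve (\<tau> m n) (L m n) x t y);
            W = (\<lambda>m n. (\<Theta> (m + 1) n - \<Theta> m (n + 1)) / 2);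
            K = (\<lambda>m n. (\<Theta> m (n + 1) - \<Theta> m (n - 1)) / 2)
        in \<forall>m n.
          norm ((\<gamma> m (n + 1) - \<gamma> m n) /\<^sub>R a n) = 1 \<and>
          (\<gamma> m (n + 1) - \<gamma> m n) /\<^sub>R a n
            = rot (K m n) *v ((\<gamma> m n - \<gamma> m (n - 1)) /\<^sub>R a (n - 1)) \<and>
          (\<gamma> (m + 1) n - \<gamma> m n) /\<^sub>R b m
            = rot (W m n) *v ((\<gamma> m (n + 1) - \<gamma> m n) /\<^sub>R a n) \<and>
          tan_eq ((\<Theta> (m + 1) (n + 1) - \<Theta> m n) / 4) (b m) (a n)
                 ((\<Theta> (m + 1) n - \<Theta> m (n + 1)) / 4))"
proof (intro conjI allI; unfold Let_def; intro allI conjI)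
  note ex = log_branch_exp[OF log_branch tau_nz] and re = log_branch_Re[OF log_branch tau_nz]
    and sm = log_branch_smooth[OF log_branch tau_nz] and th = Theta_eq[OF log_branch tau_nz]
  \<comment> \<open>This gives the exponents the form \<open>\<i> * of_real u\<close> required by
    \<open>discrete_potential_mkdv\<close>.\<close>
  have l_eq: "L m n x t y = \<i> * of_real (Im (L m n x t y))" for m n x t y
    by (simp add: complex_eq_iff re)
  have dx_eq: "dx (L m n) x t y = \<i> * of_real (Im (dx (L m n) x t y))" for m n x t y
    by (simp add: complex_eq_iff dx_imaginary[OF sm re])
  fix m n :: int
  {
    fix y x t :: real
    note g = pd1_gamma_curve[OF tau_smooth tau_nz log_branch bil1]
    let ?L = "L m n" and ?l = "Im (dx (L m n) x t y)"
    note k = th pd1_Im[OF sm] pd2_Im[OF sm] pd1_Im[OF smooth3_dx[OF sm]]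
      pd1_Im[OF smooth3_dx[OF smooth3_dx[OF sm]]]
    have "dt ?L x t y + dx (dx (dx ?L)) x t y = 2 * dx ?L x t y ^ 3"
      using tau_nz ex bil2 bil3
      by (intro bilinear_imp_mkdv[OF sm tau_smooth smooth3_conj3[OF tau_smooth]])
        (simp_all add: conj3_def)
    also have "\<dots> = 2 * (\<i> * of_real ?l) ^ 3"
      by (subst dx_eq) (rule refl)
    also have "\<dots> = - \<i> * of_real (2 * ?l ^ 3)"
      by (simp add: power_mult_distrib power3_eq_cube)
    finally have c: "dt ?L x t y + dx (dx (dx ?L)) x t y = - \<i> * of_real (2 * ?l ^ 3)" .
    \<comment> \<open>As \<open>\<theta>\<close> is twice \<open>Im L\<close>, doubling makes the
      right-hand side \<open>- 4 * ?l ^ 3\<close>, which is minus half the cube of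
      \<open>\<kappa> = 2 * ?l\<close>.\<close>
    have mkdv: "Im (dt ?L x t y) + Im (dx (dx (dx ?L)) x t y) = - 2 * ?l ^ 3"
      using arg_cong[OF c, of Im] by simp
    show "pd2 (\<lambda>x t. Theta ?L x t y) x t + 1 / 2 * (pd1 (\<lambda>x t. Theta ?L x t y) x t) ^ 3
        + pd1 (pd1 (pd1 (\<lambda>x t. Theta ?L x t y))) x t = 0"
      unfolding k using mkdv by (simp add: power_mult_distrib)
    \<comment> \<open>The factor is \<open>\<i> * \<kappa>\<close>, a quarter turn scaled by the
      curvature.\<close>
    have "2 * dx ?L x t y = Complex 0 (2 * ?l)"
      by (simp add: complex_eq_iff dx_imaginary[OF sm re])
    then show "pd1 (pd1 (\<lambda>x t. gamma_curve (\<tau> m n) ?L x t y)) x t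
        = mat2 0 (- pd1 (\<lambda>x t. Theta ?L x t y) x t) (pd1 (\<lambda>x t. Theta ?L x t y) x t) 0
          *v pd1 (\<lambda>x t. gamma_curve (\<tau> m n) ?L x t y) x t"
      unfolding g k pd1_cvec_exp[OF sm] mat2_mult_cvec by simp
    \<comment> \<open>The evolution equation trades the time derivative of the angle for
      \<open>x\<close>-derivatives of \<open>\<kappa>\<close>.\<close>
    have "2 * dt ?L x t y = Complex 0 (- 2 * Im (dx (dx (dx ?L)) x t y) - (2 * ?l) ^ 3 / 2)"
      using mkdv by (simp add: complex_eq_iff dt_imaginary[OF sm re] power_mult_distrib)
    then show "pd2 (pd1 (\<lambda>x t. gamma_curve (\<tau> m n) ?L x t y)) x t
        = mat2 0 (pd1 (pd1 (pd1 (\<lambda>x t. Theta ?L x t y))) x t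
              + pd1 (\<lambda>x t. Theta ?L x t y) x t ^ 3 / 2)
            (- pd1 (pd1 (pd1 (\<lambda>x t. Theta ?L x t y))) x t
              - pd1 (\<lambda>x t. Theta ?L x t y) x t ^ 3 / 2) 0
          *v pd1 (\<lambda>x t. gamma_curve (\<tau> m n) ?L x t y) x t"
      using mat2_mult_cvec[of 0 "- 2 * Im (dx (dx (dx ?L)) x t y) - (2 * ?l) ^ 3 / 2"]
      unfolding g k pd2_cvec_exp[OF sm] by (simp add: add.commute)
  }
  fix x t y :: real
  let ?\<Theta> = "\<lambda>m n. Theta (L m n) x t y" and ?\<gamma> = "\<lambda>m n. gamma_curve (\<tau> m n) (L m n) x t y"
  \<comment> \<open>Stated for every \<open>n\<close>, because the edge arriving at \<open>n\<close>
    is the instance \<open>n - 1\<close>.\<close>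
  have edge_n: "(?\<gamma> m (n + 1) - ?\<gamma> m n) /\<^sub>R a n
      = cvec (cis (Im (L m (n + 1) x t y) + Im (L m n x t y)))" for n
    by (rule gamma_curve_diff[OF tau_smooth tau_nz log_branch tau_smooth tau_nz log_branch
          bil4 a_nz])
  have edge_prev: "(?\<gamma> m n - ?\<gamma> m (n - 1)) /\<^sub>R a (n - 1)
      = cvec (cis (Im (L m n x t y) + Im (L m (n - 1) x t y)))"
    using edge_n[of "n - 1"] by simp
  have edge_m: "(?\<gamma> (m + 1) n - ?\<gamma> m n) /\<^sub>R b m
      = cvec (cis (Im (L (m + 1) n x t y) + Im (L m n x t y)))"
    by (rule gamma_curve_diff[OF tau_smooth tau_nz log_branch tau_smooth tau_nz log_branch
          bil5 b_nz])
  show "norm ((?\<gamma> m (n + 1) - ?\<gamma> m n) /\<^sub>R a n) = 1"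
    unfolding edge_n norm_cvec by simp
  \<comment> \<open>The rotation angle is the difference of the edge angles; the shared
    \<open>Im (L m n x t y)\<close> cancels.\<close>
  show "(?\<gamma> m (n + 1) - ?\<gamma> m n) /\<^sub>R a n
      = rot ((?\<Theta> m (n + 1) - ?\<Theta> m (n - 1)) / 2) *v ((?\<gamma> m n - ?\<gamma> m (n - 1)) /\<^sub>R a (n - 1))"
    unfolding edge_n edge_prev th by (simp add: rot_mult_cvec cis_mult diff_divide_distrib)
  show "(?\<gamma> (m + 1) n - ?\<gamma> m n) /\<^sub>R b m
      = rot ((?\<Theta> (m + 1) n - ?\<Theta> m (n + 1)) / 2) *v ((?\<gamma> m (n + 1) - ?\<gamma> m n) /\<^sub>R a n)"
    unfolding edge_n edge_m th by (simp add: rot_mult_cvec cis_mult diff_divide_distrib)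
  \<comment> \<open>Halves of \<open>Im L\<close> are quarters of \<open>Theta\<close>.\<close>
  have "tan_eq ((Im (L (m + 1) (n + 1) x t y) - Im (L m n x t y)) / 2) (b m) (a n)
      ((Im (L (m + 1) n x t y) - Im (L m (n + 1) x t y)) / 2)"
    by (rule discrete_potential_mkdv[OF ab _ _ _ _ tau_nz tau_nz tau_nz tau_nz bil6])
      (simp_all add: ex flip: l_eq)
  then show "tan_eq ((?\<Theta> (m + 1) (n + 1) - ?\<Theta> m n) / 4) (b m) (a n)
      ((?\<Theta> (m + 1) n - ?\<Theta> m (n + 1)) / 4)"
    unfolding th by (simp add: diff_divide_distrib)
qed

end
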